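(* Let $S=K[x_1,\ldots,x_n]$ be a standard graded polynomial ring over a field $K$ and let $I\subset S$ be a nonzero proper graded ideal having no embedded prime. Suppose $I$ is normally torsion-free (equivalently, $I^k=I^{(k)}$ for all $k\geq 1$). If $\mathrm v_{\mathfrak{p}}(I)=\alpha(I)-\alpha(\mathfrak{p})$ for some $\mathfrak{p}\in \operatorname{Ass}(I)$, then $\mathrm v_{\mathfrak{p}}(I^k)=\alpha(I)k-\alpha(\mathfrak{p})$ for all $k\geq 1$. Moreover, if $\mathrm{v}(I)=\alpha(I)-c(I)$, then $\mathrm{v}(I^k)=\alpha(I)k-c(I)$ for all $k\geq 1$.
   Context: $S=\bigoplus_{d\ge 0}S_d$ is graded with $\deg x_i=1$. $\operatorname{Ass}(I)$ denotes the set of associated primes of $I$ (i.e. of $S/I$); an embedded prime is an associated prime that is not minimal in $\operatorname{Ass}(I)$ under inclusion. A proper ideal $I$ is normally torsion-free if $\operatorname{Ass}(I^k)\subseteq\operatorname{Ass}(I)$ for all $k\ge 1$. $I^{(k)}$ denotes the $k$-th symbolic power of $I$, i.e. the intersection, over the minimal primes $\mathfrak p$ of $I$, of the preimages in $S$ of $I^kS_{\mathfrak p}$. For a nonzero graded ideal $I$, $\alpha(I):=\min\{\deg(f)\mid f\in I\setminus\{0\}\}$ (over homogeneous $f$). $c(I):=\max\{\alpha(\mathfrak{p})\mid \mathfrak{p}\in\operatorname{Ass}(I)\}$. For a proper graded ideal $I$ and $\mathfrak{p}\in\operatorname{Ass}(I)$, $\mathrm{v}_{\mathfrak{p}}(I):=\min\{d\geq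 0\mid \exists f\in S_d \text{ with } (I:f)=\mathfrak{p}\}$, and $\mathrm{v}(I):=\min\{d\geq 0\mid \exists f\in S_d,\ \mathfrak{p}\in\operatorname{Ass}(I)\text{ with }(I:f)=\mathfrak{p}\}$. Here $(I:f)=\{g\in S\mid gf\in I\}$. *)

theory Defs
  imports
    "HOL-Library.Poly_Mapping"
    "HOL-Algebra.Ideal_Product"
    "HOL-Algebra.Algebraic_Closure_Type"
begin

text \<open>The ring in question is the whole type, seen as a ring record, so that ideals, prime ideals
  and ideal products are those of \<^theory>\<open>HOL-Algebra.Ideal_Product\<close>.\<close>

abbreviation is_ideal :: "'a::comm_ring_1 set \<Rightarrow> bool"
  where "is_ideal I \<equiv> ideal I ring_of_type_algebra"

abbreviation is_prime_ideal :: "'a::comm_ring_1 set \<Rightarrow> bool"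
  where "is_prime_ideal P \<equiv> primeideal P ring_of_type_algebra"

abbreviation ideal_power :: "'a::comm_ring_1 set \<Rightarrow> nat \<Rightarrow> 'a set"
  where "ideal_power I k \<equiv> I [^]\<^bsub>ideals_set ring_of_type_algebra\<^esub> k"

definition colon :: "'a::comm_ring_1 set \<Rightarrow> 'a \<Rightarrow> 'a set"
  where "colon I f = {g. g * f \<in> I}"

definition Ass :: "'a::comm_ring_1 set \<Rightarrow> 'a set set"
  where "Ass I = {P. is_prime_ideal P \<and> (\<exists>f. colon I f = P)}"

definition embedded_primes :: "'a::comm_ring_1 set \<Rightarrow> 'a set set"
  where "embedded_primes I = {P \<in> Ass I. \<exists>Q \<in> Ass I. Q \<subset> P}"

definition minimal_primes :: "'a::comm_ring_1 set \<Rightarrow> 'a set set"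
  where "minimal_primes I =
    {P. is_prime_ideal P \<and> I \<subseteq> P \<and> (\<forall>Q. is_prime_ideal Q \<and> I \<subseteq> Q \<and> Q \<subseteq> P \<longrightarrow> Q = P)}"

definition normally_torsion_free :: "'a::comm_ring_1 set \<Rightarrow> bool"
  where "normally_torsion_free I \<longleftrightarrow>
    is_ideal I \<and> I \<noteq> UNIV \<and> (\<forall>k\<ge>1. Ass (ideal_power I k) \<subseteq> Ass I)"

text \<open>Elements of the localization at a prime ideal \<open>P\<close> are equivalence classes of pairs
  \<open>(a, s)\<close> with \<open>s \<notin> P\<close>, standing for the fraction \<open>a / s\<close>.\<close>

definition loc_rel :: "'a::comm_ring_1 set \<Rightarrow> (('a \<times> 'a) \<times> ('a \<times> 'a)) set"
  where "loc_rel P = {((a, s), (b, t)). s \<notin> P \<and> t \<notin> P \<and> (\<exists>u. u \<notin> P \<and> u * (a * t - b * s) = 0)}"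

definition loc_frac :: "'a::comm_ring_1 set \<Rightarrow> 'a \<Rightarrow> 'a \<Rightarrow> ('a \<times> 'a) set"
  where "loc_frac P a s = loc_rel P `` {(a, s)}"

text \<open>For an ideal \<open>J\<close>, the extended ideal \<open>J S\<^sub>P\<close> consists of the fractions \<open>a / s\<close>
  with \<open>a \<in> J\<close> and \<open>s \<notin> P\<close>.\<close>

definition loc_ext :: "'a::comm_ring_1 set \<Rightarrow> 'a set \<Rightarrow> ('a \<times> 'a) set set"
  where "loc_ext P J = {loc_frac P a s | a s. a \<in> J \<and> s \<notin> P}"

definition symbolic_power :: "'a::comm_ring_1 set \<Rightarrow> nat \<Rightarrow> 'a set"
  where "symbolic_power I k =
    (\<Inter>P \<in> minimal_primes I. {f. loc_frac P f 1 \<in> loc_ext P (ideal_power I k)})"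

text \<open>\<open>('n, 'k) mpoly\<close>, with \<open>'n\<close> finite and \<open>'k\<close> a field, is the polynomial ring over \<open>'k\<close> in
  \<open>n = CARD('n)\<close> variables: a polynomial maps exponent vectors to coefficients.\<close>

type_synonym ('n, 'k) mpoly = "('n \<Rightarrow>\<^sub>0 nat) \<Rightarrow>\<^sub>0 'k"

definition mdeg :: "('n::finite \<Rightarrow>\<^sub>0 nat) \<Rightarrow> nat"
  where "mdeg m = (\<Sum>i\<in>UNIV. Poly_Mapping.lookup m i)"

text \<open>The graded piece of degree \<open>d\<close> contains \<open>0\<close> for every \<open>d\<close>.\<close>

definition graded_part :: "nat \<Rightarrow> ('n::finite, 'k::field) mpoly set"
  where "graded_part d = {f. \<forall>m \<in> Poly_Mapping.keys f. mdeg m = d}"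

definition hom_component :: "nat \<Rightarrow> ('n::finite, 'k::field) mpoly \<Rightarrow> ('n, 'k) mpoly"
  where "hom_component d f =
    (\<Sum>m \<in> {m \<in> Poly_Mapping.keys f. mdeg m = d}. Poly_Mapping.single m (Poly_Mapping.lookup f m))"

definition graded_ideal :: "('n::finite, 'k::field) mpoly set \<Rightarrow> bool"
  where "graded_ideal I \<longleftrightarrow> is_ideal I \<and> (\<forall>f \<in> I. \<forall>d. hom_component d f \<in> I)"

text \<open>The minima and the maximum below are meant for nonzero proper graded ideals \<open>I\<close> and
  \<open>P \<in> Ass I\<close>; the sets involved are then nonempty. Moreover \<open>I \<subseteq> P\<close> gives
  \<open>initial_degree P \<le> initial_degree I\<close>, so the maximum is over a finite set.\<close>

definition initial_degree :: "('n::finite, 'k::field) mpoly set \<Rightarrow> nat"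
  where "initial_degree I = (LEAST d. \<exists>f \<in> I - {0}. f \<in> graded_part d)"

definition max_initial_degree :: "('n::finite, 'k::field) mpoly set \<Rightarrow> nat"
  where "max_initial_degree I = Max (initial_degree ` Ass I)"

definition local_v_number :: "('n::finite, 'k::field) mpoly set \<Rightarrow> ('n, 'k) mpoly set \<Rightarrow> nat"
  where "local_v_number P I = (LEAST d. \<exists>f \<in> graded_part d. colon I f = P)"

definition v_number :: "('n::finite, 'k::field) mpoly set \<Rightarrow> nat"
  where "v_number I = (LEAST d. \<exists>f \<in> graded_part d. \<exists>P \<in> Ass I. colon I f = P)"

end

theory Submission
  imports Defs "HOL-Computational_Algebra.Primes"
begin

text \<open>
  Write \<open>\<alpha>\<close> for the initial degree. The statement combines a criterion that holds in every Noetherian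
  commutative ring with a degree count in the polynomial ring.

  The criterion, \<open>normally_torsion_free_iff_symbolic_powers\<close>: in a Noetherian ring \<open>f \<notin> J\<close> holds exactly
  if \<open>(J : f)\<close> lies in an associated prime of \<open>J\<close>, while \<open>f\<close> is outside the symbolic power \<open>I\<^sup>(\<^sup>k\<^sup>)\<close>
  exactly if \<open>(I\<^sup>k : f)\<close> lies in a minimal prime of \<open>I\<close>. In the absence of embedded primes the associated
  primes of \<open>I\<close> are the minimal ones, so both powers agree as soon as \<open>I\<^sup>k\<close> has no further
  associated primes, and conversely. The existence of the primes involved comes from maximal colon
  ideals (\<open>prime_on_maximal_colon\<close>).

  The degree count: if \<open>(I\<^sup>k : g) = P\<close> with \<open>g\<close> a form, multiplying \<open>g\<close> by a form of degree \<open>\<alpha>(P)\<close> in \<open>P\<close>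
  gives a nonzero form in \<open>I\<^sup>k\<close>, so \<open>deg g \<ge> k \<alpha>(I) - \<alpha>(P)\<close>
  (\<open>homogeneous_witness_degree_bound\<close>). If the bound is attained for \<open>k = 1\<close> by \<open>f\<close>, it is attained for
  every \<open>k\<close> by \<open>h\<^sup>k\<^sup>-\<^sup>1 f\<close>, where \<open>h \<in> I\<close> is a form of degree \<open>\<alpha>(I)\<close>
  (\<open>homogeneous_witness_for_power\<close>). For the v-number without a prescribed prime, the hypothesis forces
  the prime of an optimal witness to have the largest possible initial degree, and the same witnesses
  serve.

  Two facts about the polynomial ring support this. It is Noetherian (\<open>mpoly_noetherian\<close>), by Dickson's
  lemma applied to leading exponents. And a minimal prime of a graded ideal is the colon by a form
  (\<open>minimal_prime_homogeneous_witness\<close>), so that the minima defining the v-numbers are attained.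
\<close>

section \<open>Ideals and ideal powers in a commutative ring\<close>

lemma ring_of_type_algebra_simps [simp]:
  "carrier ring_of_type_algebra = UNIV"
  "x \<otimes>\<^bsub>ring_of_type_algebra\<^esub> y = x * y"
  "x \<oplus>\<^bsub>ring_of_type_algebra\<^esub> y = x + y"
  "\<one>\<^bsub>ring_of_type_algebra\<^esub> = 1"
  "\<zero>\<^bsub>ring_of_type_algebra\<^esub> = 0"
  by (simp_all add: ring_of_type_algebra_def)

text \<open>Membership rules in terms of the type class operations, so that the rest of the development
  stays clear of the record structure.\<close>

lemma is_ideal_iff:
  "is_ideal I \<longleftrightarrow> 0 \<in> I \<and> (\<forall>a\<in>I. \<forall>b\<in>I. a + b \<in> I) \<and> (\<forall>a\<in>I. \<forall>x. x * a \<in> I)"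
  (is "_ \<longleftrightarrow> ?R")
proof
  assume I: "is_ideal I"
  note add = ideal.axioms(1)[OF I]
  show ?R
    using additive_subgroup.zero_closed[OF add] additive_subgroup.a_closed[OF add]
      ideal.I_l_closed[OF I]
    unfolding ring_of_type_algebra_simps by blast
next
  assume R: ?R
  have neg: "- a \<in> I" if "a \<in> I" for a
    using R that by (metis mult_minus1)
  have inv: "inv\<^bsub>add_monoid ring_of_type_algebra\<^esub> a = - a" for a :: 'a
    using abelian_group.minus_equality[of ring_of_type_algebra "- a" a]
      ring.is_abelian_group[OF ring_from_type_algebra]
    by (simp add: a_inv_def)
  have "subgroup I (add_monoid ring_of_type_algebra)"
    unfolding subgroup_def inv using R neg by simp
  moreover have "a * x \<in> I" if "a \<in> I" for a x
    using R that by (subst mult.commute) blast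
  ultimately show "is_ideal I"
    using R by (intro idealI ring_from_type_algebra) (auto simp only: ring_of_type_algebra_simps)
qed

lemma ideal_zero: "is_ideal I \<Longrightarrow> 0 \<in> I"
  and ideal_add: "is_ideal I \<Longrightarrow> a \<in> I \<Longrightarrow> b \<in> I \<Longrightarrow> a + b \<in> I"
  and ideal_lmult: "is_ideal I \<Longrightarrow> a \<in> I \<Longrightarrow> x * a \<in> I"
  and ideal_rmult: "is_ideal I \<Longrightarrow> a \<in> I \<Longrightarrow> a * x \<in> I"
  unfolding is_ideal_iff by (simp_all, metis mult.commute)

lemma ideal_diff:
  assumes "is_ideal I" "a \<in> I" "b \<in> I"
  shows "a - b \<in> I"
  using ideal_add[OF assms(1,2) ideal_lmult[OF assms(1,3), of "- 1"]] by simp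

lemma ideal_sum: "is_ideal I \<Longrightarrow> (\<And>i. i \<in> A \<Longrightarrow> f i \<in> I) \<Longrightarrow> sum f A \<in> I"
  by (induction A rule: infinite_finite_induct) (auto intro: ideal_zero ideal_add)

lemma ideal_eq_UNIV: "is_ideal I \<Longrightarrow> 1 \<in> I \<Longrightarrow> I = UNIV"
  using ideal_lmult[of I 1] by auto

lemma is_prime_ideal_iff:
  "is_prime_ideal P \<longleftrightarrow> is_ideal P \<and> 1 \<notin> P \<and> (\<forall>a b. a * b \<in> P \<longrightarrow> a \<in> P \<or> b \<in> P)"
  (is "_ \<longleftrightarrow> ?R")
proof
  assume P: "is_prime_ideal P"
  then have ideal: "is_ideal P" by (simp add: primeideal_def)
  show ?R
    using primeideal.I_notcarr[OF P] primeideal.I_prime[OF P] ideal ideal_eq_UNIV[OF ideal]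
    unfolding ring_of_type_algebra_simps by blast
next
  assume R: ?R
  then have "P \<noteq> UNIV" by auto
  with R show "is_prime_ideal P"
    by (intro primeidealI cring_from_type_algebra) (unfold ring_of_type_algebra_simps, blast+)
qed

lemma prime_imp_ideal: "is_prime_ideal P \<Longrightarrow> is_ideal P"
  by (simp add: is_prime_ideal_iff)

lemma ideal_power_0: "ideal_power I 0 = UNIV"
  by (simp add: ideals_set_def nat_pow_def)

lemma ideal_power_Suc: "ideal_power I (Suc k) = ideal_prod ring_of_type_algebra (ideal_power I k) I"
  by (simp add: ideals_set_def nat_pow_def)

lemma is_ideal_power: 
  assumes "is_ideal I" shows "is_ideal (ideal_power I k)"
proof (induction k)
  case 0
  show ?case unfolding ideal_power_0 is_ideal_iff by simp
next
  case (Suc k)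
  show ?case
    unfolding ideal_power_Suc by (rule ring.ideal_prod_is_ideal[OF ring_from_type_algebra Suc assms])
qed

lemma mult_mem_ideal_power: 
  "a \<in> ideal_power I k \<Longrightarrow> b \<in> I \<Longrightarrow> a * b \<in> ideal_power I (Suc k)"
  unfolding ideal_power_Suc
  using ideal_prod.prod[of a "ideal_power I k" b I ring_of_type_algebra]
  by simp

lemma ideal_power_Suc_induct [consumes 1, case_names mult add]:
  assumes "x \<in> ideal_power I (Suc k)"
    and "\<And>a b. a \<in> ideal_power I k \<Longrightarrow> b \<in> I \<Longrightarrow> Q (a * b)"
    and "\<And>a b. Q a \<Longrightarrow> Q b \<Longrightarrow> Q (a + b)"
  shows "Q x"
  using assms(1) unfolding ideal_power_Suc
  by (induction rule: ideal_prod.induct) (use assms(2,3) in auto)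

lemma power_mem_ideal_power: "a \<in> I \<Longrightarrow> a ^ k \<in> ideal_power I k"
proof (induction k)
  case 0
  show ?case unfolding ideal_power_0 by simp
next
  case (Suc k)
  then show ?case using mult_mem_ideal_power[of "a ^ k" I k a] by (simp add: mult.commute)
qed

lemma ideal_power_Suc_subset: "is_ideal I \<Longrightarrow> ideal_power I (Suc k) \<subseteq> I"
proof
  fix x assume I: "is_ideal I" and "x \<in> ideal_power I (Suc k)"
  from this(2) show "x \<in> I"
    by (induction rule: ideal_power_Suc_induct) (auto intro: ideal_add[OF I] ideal_lmult[OF I])
qed

lemma ideal_power_1:
  assumes "is_ideal I" shows "ideal_power I 1 = I"
proof
  show "ideal_power I 1 \<subseteq> I" using ideal_power_Suc_subset[OF assms, of 0] by simp
  have "1 \<in> ideal_power I 0" unfolding ideal_power_0 by simp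
  then show "I \<subseteq> ideal_power I 1" using mult_mem_ideal_power[of 1 I 0] by auto
qed

lemma prime_mem_of_power_mem: "is_prime_ideal P \<Longrightarrow> a ^ k \<in> P \<Longrightarrow> a \<in> P"
  by (induction k) (auto simp: is_prime_ideal_iff)

lemma prime_contains_of_contains_ideal_power:
  assumes "is_prime_ideal P" "ideal_power I k \<subseteq> P"
  shows "I \<subseteq> P"
  using assms power_mem_ideal_power prime_mem_of_power_mem by blast

section \<open>Colon ideals and associated primes\<close>

lemma mem_colon: "g \<in> colon I f \<longleftrightarrow> g * f \<in> I"
  by (simp add: colon_def)

lemma is_ideal_colon: "is_ideal I \<Longrightarrow> is_ideal (colon I f)"
  unfolding is_ideal_iff by (simp add: mem_colon distrib_right mult.assoc)

lemma colon_mult_mono: "is_ideal I \<Longrightarrow> colon I f \<subseteq> colon I (h * f)"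
  by (auto simp: mem_colon mult.left_commute[of _ h] intro: ideal_lmult)

lemma ideal_subset_colon: "is_ideal I \<Longrightarrow> I \<subseteq> colon I f"
  by (auto simp: mem_colon intro: ideal_rmult)

lemma AssD: assumes "P \<in> Ass I" shows "is_prime_ideal P" "\<exists>f. colon I f = P"
  using assms by (auto simp: Ass_def)

lemma Ass_contains: "is_ideal I \<Longrightarrow> P \<in> Ass I \<Longrightarrow> I \<subseteq> P"
  using ideal_subset_colon by (auto simp: Ass_def)

text \<open>Well-foundedness of this relation is the ascending chain condition: it is the form in which
  the Noetherian hypothesis enters below.\<close>

definition strictly_larger_ideal :: "('a::comm_ring_1 set \<times> 'a set) set"
  where "strictly_larger_ideal = {(J', J). is_ideal J' \<and> is_ideal J \<and> J \<subset> J'}"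

text \<open>Among the colons \<open>(J : h f)\<close> with \<open>h \<in> H\<close> that avoid \<open>T\<close>, a maximal one behaves like a
  prime ideal on \<open>H\<close>. For if \<open>a b h f \<in> J\<close> with \<open>a\<close> and \<open>b\<close> outside the colon, then
  \<open>(J : b h f)\<close> contains \<open>a\<close>, so it is larger and must meet \<open>T\<close> in some \<open>s \<in> H\<close>; then \<open>(J : s h f)\<close> contains
  \<open>b\<close>, so it must meet \<open>T\<close> in some \<open>t\<close>, and \<open>t s\<close> is an element of \<open>T\<close> in the original colon.

  Two instances matter. With \<open>H\<close> the whole ring this produces associated primes; with \<open>H\<close> the
  homogeneous elements it produces homogeneous witnesses for them.\<close>

lemma prime_on_maximal_colon:
  fixes J :: "'a::comm_ring_1 set"
  assumes noeth: "wf (strictly_larger_ideal :: ('a set \<times> 'a set) set)"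
    and J: "is_ideal J"
    and T: "\<And>s t. s \<in> T \<Longrightarrow> t \<in> T \<Longrightarrow> s * t \<in> T"
    and H: "1 \<in> H" "\<And>a b. a \<in> H \<Longrightarrow> b \<in> H \<Longrightarrow> a * b \<in> H"
    and HT: "\<And>h. h \<in> H \<Longrightarrow> colon J (h * f) \<inter> T \<noteq> {} \<Longrightarrow> colon J (h * f) \<inter> T \<inter> H \<noteq> {}"
    and f: "colon J f \<inter> T = {}"
  obtains h where "h \<in> H" "colon J (h * f) \<inter> T = {}"
    "\<And>a b. a \<in> H \<Longrightarrow> b \<in> H \<Longrightarrow> a * b \<in> colon J (h * f) \<Longrightarrow>
      a \<in> colon J (h * f) \<or> b \<in> colon J (h * f)"
proof -
  define F where "F = {colon J (h * f) | h. h \<in> H \<and> colon J (h * f) \<inter> T = {}}"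
  have "colon J (1 * f) \<in> F"
    using f H(1) by (auto simp: F_def intro!: exI[of _ 1])
  from wfE_min[OF noeth this] obtain M where M: "M \<in> F"
    and max: "\<And>M'. (M', M) \<in> strictly_larger_ideal \<Longrightarrow> M' \<notin> F" by blast
  from M obtain h where h: "h \<in> H" "M = colon J (h * f)" "M \<inter> T = {}"
    by (auto simp: F_def)
  \<comment> \<open>Multiplying by an element of \<open>H\<close> that some \<open>x\<close> outside \<open>M\<close> sends into \<open>M\<close> enlarges the colon.\<close>
  have grow: "\<exists>s \<in> T \<inter> H. s * y \<in> M" if y: "y \<in> H" and x: "x * y \<in> M" "x \<notin> M" for x y
  proof -
    have "M \<subset> colon J (y * h * f)"
      using colon_mult_mono[OF J, of "h * f" y] x by (auto simp: h mem_colon mult.assoc)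
    then have "(colon J (y * h * f), M) \<in> strictly_larger_ideal"
      by (auto simp: strictly_larger_ideal_def h is_ideal_colon[OF J])
    then have "colon J (y * h * f) \<inter> T \<noteq> {}"
      using max H(2)[OF y h(1)] unfolding F_def by blast
    then show ?thesis
      using HT[OF H(2)[OF y h(1)]] by (auto simp: h mem_colon mult.assoc)
  qed
  show thesis
  proof (rule that[OF h(1)])
    show "colon J (h * f) \<inter> T = {}" using h by simp
    fix a b assume ab: "a \<in> H" "b \<in> H" "a * b \<in> colon J (h * f)"
    show "a \<in> colon J (h * f) \<or> b \<in> colon J (h * f)"
    proof (rule ccontr)
      assume "\<not> ?thesis"
      then have nin: "a \<notin> M" "b \<notin> M" by (simp_all add: h)
      then obtain s where s: "s \<in> T" "s \<in> H" "s * b \<in> M" using grow[of b a] ab h by auto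
      then obtain t where "t \<in> T" "t * s \<in> M"
        using grow[of s b] nin by (auto simp: mult.commute)
      then show False using T s h(3) by blast
    qed
  qed
qed

lemma prime_colon_avoiding:
  fixes J :: "'a::comm_ring_1 set"
  assumes noeth: "wf (strictly_larger_ideal :: ('a set \<times> 'a set) set)"
    and J: "is_ideal J"
    and T: "1 \<in> T" "\<And>s t. s \<in> T \<Longrightarrow> t \<in> T \<Longrightarrow> s * t \<in> T"
    and f: "colon J f \<inter> T = {}"
  obtains h where "colon J (h * f) \<in> Ass J" "colon J (h * f) \<inter> T = {}"
proof -
  obtain h where h: "colon J (h * f) \<inter> T = {}"
    "\<And>a b. a * b \<in> colon J (h * f) \<Longrightarrow> a \<in> colon J (h * f) \<or> b \<in> colon J (h * f)"
    by (rule prime_on_maximal_colon[OF noeth J T(2) _ _ _ f, where H = UNIV]) auto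
  then have "is_prime_ideal (colon J (h * f))"
    using T(1) is_ideal_colon[OF J] by (auto simp: is_prime_ideal_iff)
  then have "colon J (h * f) \<in> Ass J" unfolding Ass_def by blast
  with h(1) that show thesis by blast
qed

text \<open>The case \<open>T = {1}\<close>: every element outside \<open>J\<close> is detected by an associated prime.\<close>

lemma colon_subset_associated_prime:
  fixes J :: "'a::comm_ring_1 set"
  assumes noeth: "wf (strictly_larger_ideal :: ('a set \<times> 'a set) set)"
    and J: "is_ideal J" and "f \<notin> J"
  obtains P where "P \<in> Ass J" "colon J f \<subseteq> P"
proof -
  from assms have "colon J f \<inter> {1} = {}" by (simp add: mem_colon)
  then obtain h where "colon J (h * f) \<in> Ass J"
    by (rule prime_colon_avoiding[OF noeth J, rotated 2]) auto
  with that colon_mult_mono[OF J] show thesis by blast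
qed

text \<open>The case where \<open>T\<close> is the complement of \<open>Q\<close>. It replaces primary decomposition: minimal
  primes are associated, and associated primes that are not embedded are minimal.\<close>

lemma associated_prime_below_prime:
  fixes J :: "'a::comm_ring_1 set"
  assumes noeth: "wf (strictly_larger_ideal :: ('a set \<times> 'a set) set)"
    and J: "is_ideal J" and Q: "is_prime_ideal Q" "J \<subseteq> Q"
  obtains P where "P \<in> Ass J" "P \<subseteq> Q"
proof -
  from Q have "colon J 1 \<inter> - Q = {}" by (auto simp: mem_colon)
  then obtain h where "colon J (h * 1) \<in> Ass J" "colon J (h * 1) \<inter> - Q = {}"
    by (rule prime_colon_avoiding[OF noeth J, rotated 2]) (use Q in \<open>auto simp: is_prime_ideal_iff\<close>)
  with that show thesis by auto
qed

lemma minimal_prime_is_associated: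
  fixes J :: "'a::comm_ring_1 set"
  assumes noeth: "wf (strictly_larger_ideal :: ('a set \<times> 'a set) set)"
    and J: "is_ideal J" and P: "P \<in> minimal_primes J"
  shows "P \<in> Ass J"
proof -
  from P have "is_prime_ideal P" "J \<subseteq> P" by (simp_all add: minimal_primes_def)
  then obtain Q where Q: "Q \<in> Ass J" "Q \<subseteq> P" by (rule associated_prime_below_prime[OF noeth J])
  with P AssD(1)[OF Q(1)] Ass_contains[OF J Q(1)] have "Q = P" by (simp add: minimal_primes_def)
  with Q(1) show ?thesis by simp
qed

lemma Ass_eq_of_subset:
  "embedded_primes I = {} \<Longrightarrow> P \<in> Ass I \<Longrightarrow> Q \<in> Ass I \<Longrightarrow> P \<subseteq> Q \<Longrightarrow> P = Q"
  unfolding embedded_primes_def by blast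

lemma associated_prime_is_minimal:
  fixes J :: "'a::comm_ring_1 set"
  assumes noeth: "wf (strictly_larger_ideal :: ('a set \<times> 'a set) set)"
    and J: "is_ideal J" and emb: "embedded_primes J = {}" and P: "P \<in> Ass J"
  shows "P \<in> minimal_primes J"
  unfolding minimal_primes_def
proof (intro CollectI conjI allI impI)
  show "is_prime_ideal P" "J \<subseteq> P" using AssD[OF P] Ass_contains[OF J P] by auto
  fix Q assume Q: "is_prime_ideal Q \<and> J \<subseteq> Q \<and> Q \<subseteq> P"
  then have "is_prime_ideal Q" "J \<subseteq> Q" by simp_all
  then obtain Q' where "Q' \<in> Ass J" "Q' \<subseteq> Q" by (rule associated_prime_below_prime[OF noeth J])
  with Q Ass_eq_of_subset[OF emb _ P] show "Q = P" by blast
qed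

section \<open>Localization and symbolic powers\<close>

text \<open>The fraction \<open>f / 1\<close> lies in the extension of \<open>J\<close> exactly if some denominator outside \<open>P\<close>
  carries \<open>f\<close> into \<open>J\<close>.\<close>

lemma loc_frac_mem_loc_ext_iff:
  assumes P: "is_prime_ideal P" and J: "is_ideal J"
  shows "loc_frac P f 1 \<in> loc_ext P J \<longleftrightarrow> \<not> colon J f \<subseteq> P"
proof
  assume "loc_frac P f 1 \<in> loc_ext P J"
  then obtain a s where a: "a \<in> J" and s: "s \<notin> P" and eq: "loc_frac P f 1 = loc_frac P a s"
    by (auto simp: loc_ext_def)
  have one: "1 \<notin> P" using P by (simp add: is_prime_ideal_iff)
  then have "(a, s) \<in> loc_frac P a s"
    using s by (auto simp: loc_frac_def loc_rel_def intro!: exI[of _ 1])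
  then obtain u where u: "u \<notin> P" "u * (f * s - a) = 0"
    unfolding eq[symmetric] by (auto simp: loc_frac_def loc_rel_def)
  then have "(u * s) * f = u * a" by (simp add: algebra_simps)
  then have "u * s \<in> colon J f" using ideal_lmult[OF J a] by (simp add: mem_colon)
  moreover have "u * s \<notin> P" using u s P by (auto simp: is_prime_ideal_iff)
  ultimately show "\<not> colon J f \<subseteq> P" by blast
next
  assume "\<not> colon J f \<subseteq> P"
  then obtain s where s: "s * f \<in> J" "s \<notin> P" unfolding subset_iff mem_colon by blast
  have nP: "x * y \<notin> P" if "x \<notin> P" "y \<notin> P" for x y
    using P that by (auto simp: is_prime_ideal_iff)
  have one: "1 \<notin> P" using P by (simp add: is_prime_ideal_iff)
  \<comment> \<open>The pairs equivalent to \<open>(f, 1)\<close> are those equivalent to \<open>(s f, s)\<close>.\<close>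
  have "(\<exists>u. u \<notin> P \<and> u * (f * t - b * 1) = 0) \<longleftrightarrow> (\<exists>u. u \<notin> P \<and> u * (s * f * t - b * s) = 0)"
    (is "?L \<longleftrightarrow> ?R") for b t
  proof
    assume ?L
    then obtain u where "u \<notin> P" "u * (f * t - b * 1) = 0" by blast
    moreover have "u * (s * f * t - b * s) = s * (u * (f * t - b * 1))" by (simp add: algebra_simps)
    ultimately show ?R by (metis mult_zero_right)
  next
    assume ?R
    then obtain u where u: "u \<notin> P" "u * (s * f * t - b * s) = 0" by blast
    moreover have "(u * s) * (f * t - b * 1) = u * (s * f * t - b * s)" by (simp add: algebra_simps)
    ultimately show ?L using nP[OF u(1) s(2)] by metis
  qed
  then have "loc_frac P f 1 = loc_frac P (s * f) s"
    using s(2) one by (auto simp: loc_frac_def loc_rel_def)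
  with s show "loc_frac P f 1 \<in> loc_ext P J" by (auto simp: loc_ext_def)
qed

lemma mem_symbolic_power_iff:
  assumes "is_ideal I"
  shows "f \<in> symbolic_power I k \<longleftrightarrow> (\<forall>P \<in> minimal_primes I. \<not> colon (ideal_power I k) f \<subseteq> P)"
  using loc_frac_mem_loc_ext_iff[OF _ is_ideal_power[OF assms]]
  by (auto simp: symbolic_power_def minimal_primes_def)

text \<open>An element outside \<open>I\<^sup>k\<close> is detected by an associated prime of \<open>I\<^sup>k\<close>, and an element outside
  the symbolic power by a minimal prime of \<open>I\<close>. The two powers agree when these primes are the
  same. Conversely, if the powers agree, an associated prime \<open>(I\<^sup>k : f)\<close> is contained in a minimal prime
  of \<open>I\<close>, hence equal to it.\<close>

theorem normally_torsion_free_iff_symbolic_powers: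
  fixes I :: "'a::comm_ring_1 set"
  assumes noeth: "wf (strictly_larger_ideal :: ('a set \<times> 'a set) set)"
    and I: "is_ideal I" and proper: "I \<noteq> UNIV" and emb: "embedded_primes I = {}"
  shows "normally_torsion_free I \<longleftrightarrow> (\<forall>k\<ge>1. ideal_power I k = symbolic_power I k)"
proof
  assume ntf: "normally_torsion_free I"
  show "\<forall>k\<ge>1. ideal_power I k = symbolic_power I k"
  proof (intro allI impI subset_antisym subsetI)
    fix k f assume "f \<in> ideal_power I k"
    then have "1 \<in> colon (ideal_power I k) f" by (simp add: mem_colon)
    then show "f \<in> symbolic_power I k"
      by (auto simp: mem_symbolic_power_iff[OF I] minimal_primes_def is_prime_ideal_iff)
  next
    fix k :: nat and f assume k: "k \<ge> 1" and f: "f \<in> symbolic_power I k"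
    show "f \<in> ideal_power I k"
    proof (rule ccontr)
      assume "f \<notin> ideal_power I k"
      then obtain P where P: "P \<in> Ass (ideal_power I k)" "colon (ideal_power I k) f \<subseteq> P"
        using colon_subset_associated_prime[OF noeth is_ideal_power[OF I]] by blast
      then have "P \<in> minimal_primes I"
        using ntf k associated_prime_is_minimal[OF noeth I emb]
        by (auto simp: normally_torsion_free_def)
      with P f show False by (simp add: mem_symbolic_power_iff[OF I])
    qed
  qed
next
  assume eq: "\<forall>k\<ge>1. ideal_power I k = symbolic_power I k"
  have "P \<in> Ass I" if k: "k \<ge> 1" and P: "P \<in> Ass (ideal_power I k)" for k P
  proof -
    obtain f where f: "colon (ideal_power I k) f = P" using AssD[OF P] by blast
    have "1 \<notin> P" using AssD[OF P] by (simp add: is_prime_ideal_iff)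
    then have "f \<notin> symbolic_power I k" using f eq k by (auto simp: mem_colon)
    then obtain Q where Q: "Q \<in> minimal_primes I" "P \<subseteq> Q"
      by (auto simp: mem_symbolic_power_iff[OF I] f)
    have "I \<subseteq> P"
      using prime_contains_of_contains_ideal_power AssD[OF P] Ass_contains[OF is_ideal_power[OF I] P]
      by blast
    with Q have "P = Q" using AssD[OF P] by (auto simp: minimal_primes_def)
    with Q show ?thesis using minimal_prime_is_associated[OF noeth I] by simp
  qed
  with I proper show "normally_torsion_free I" by (auto simp: normally_torsion_free_def)
qed

section \<open>Dickson's lemma\<close>

lemma monotone_subsequence_nat:
  fixes s :: "nat \<Rightarrow> nat"
  obtains r where "strict_mono r" "incseq (s \<circ> r)"
proof -
  have "\<exists>r. \<forall>n. (\<forall>m\<ge>r n. s (r n) \<le> s m) \<and> r n < r (Suc n)"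
  proof (intro dependent_nat_choice)
    \<comment> \<open>Past any position, the least later value is a lower bound for all that follows.\<close>
    have *: "\<exists>y>x. \<forall>m\<ge>y. s y \<le> s m" for x
    proof -
      obtain y where y: "y > x" "\<And>m. m > x \<Longrightarrow> s y \<le> s m"
        using ex_has_least_nat[of "\<lambda>y. y > x" "Suc x" s] by auto
      then show ?thesis by (intro exI[of _ y]) auto
    qed
    then show "\<exists>x. \<forall>m\<ge>x. s x \<le> s m" by blast
    fix x show "\<exists>y. (\<forall>m\<ge>y. s y \<le> s m) \<and> x < y" using * by blast
  qed
  then obtain r where r: "\<And>n m. m \<ge> r n \<Longrightarrow> s (r n) \<le> s m" "\<And>n. r n < r (Suc n)" by blast
  then have "strict_mono r" by (simp add: strict_mono_Suc_iff)
  moreover have "incseq (s \<circ> r)"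
    using r(1) r(2) by (auto simp: incseq_Suc_iff intro: less_imp_le)
  ultimately show thesis using that by blast
qed

text \<open>Pass to subsequences that are monotone in one more coordinate at a time.\<close>

lemma dickson:
  fixes m :: "nat \<Rightarrow> 'n::finite \<Rightarrow> nat"
  obtains i j where "i < j" "m i \<le> m j"
proof -
  have "\<exists>r. strict_mono r \<and> (\<forall>x\<in>A. incseq (\<lambda>k. m (r k) x))" if "finite A" for A :: "'n set"
    using that
  proof induction
    case empty
    show ?case by (auto intro!: exI[of _ id] simp: strict_mono_def)
  next
    case (insert x A)
    then obtain r where r: "strict_mono r" "\<forall>x\<in>A. incseq (\<lambda>k. m (r k) x)" by blast
    obtain r' where r': "strict_mono r'" "incseq ((\<lambda>k. m (r k) x) \<circ> r')"
      by (rule monotone_subsequence_nat)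
    have "mono r'" using r'(1) by (rule strict_mono_mono)
    then have "\<forall>y\<in>insert x A. incseq (\<lambda>k. m ((r \<circ> r') k) y)"
      using r(2) r'(2) by (auto simp: incseq_def monoD o_def)
    with strict_mono_o[OF r(1) r'(1)] show ?case by blast
  qed
  from this[OF finite_UNIV] obtain r where r: "strict_mono r" "\<And>x. incseq (\<lambda>k. m (r k) x)"
    by blast
  show thesis
  proof (rule that)
    show "r 0 < r 1" using r(1) by (simp add: strict_mono_def)
    show "m (r 0) \<le> m (r 1)" using r(2) by (simp add: le_fun_def incseq_def)
  qed
qed

section \<open>Leading exponents\<close>

text \<open>A substitute for a monomial order that needs no order on the variables: a weight turning
  addition of exponents into multiplication orders the exponents linearly and compatibly with
  addition, and the order is well-founded because its values are natural numbers.\<close>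

definition monomial_weight :: "(('n \<Rightarrow>\<^sub>0 nat) \<Rightarrow> nat) \<Rightarrow> bool"
  where "monomial_weight N \<longleftrightarrow> inj N \<and> (\<forall>a b. N (a + b) = N a * N b) \<and> (\<forall>a. N a > 0)"

text \<open>Attach distinct primes to the variables; unique factorization makes the product of prime powers
  injective.\<close>

lemma exists_monomial_weight:
  obtains N :: "('n::finite \<Rightarrow>\<^sub>0 nat) \<Rightarrow> nat" where "monomial_weight N"
proof -
  obtain B :: "nat set" where B: "finite B" "card B = card (UNIV :: 'n set)" "B \<subseteq> Collect prime"
    using infinite_arbitrarily_large[OF primes_infinite, of "card (UNIV :: 'n set)"] by auto
  then obtain p :: "'n \<Rightarrow> nat" where p: "bij_betw p UNIV B"
    using finite_same_card_bij[of "UNIV :: 'n set" B] by auto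
  have prime: "prime (p i)" for i
    using B p by (auto simp: bij_betw_def)
  have inj: "inj p" using p by (simp add: bij_betw_def)
  define N :: "('n \<Rightarrow>\<^sub>0 nat) \<Rightarrow> nat" where "N a = (\<Prod>i\<in>UNIV. p i ^ Poly_Mapping.lookup a i)" for a
  have mult: "multiplicity (p i) (N a) = Poly_Mapping.lookup a i" for a i
  proof -
    have "N a = (\<Prod>q \<in> range p. q ^ Poly_Mapping.lookup a (inv_into UNIV p q))"
      unfolding N_def by (subst prod.reindex[OF inj]) (simp add: inj)
    then show ?thesis
      using multiplicity_prod_prime_powers[of "range p" "p i" "\<lambda>q. Poly_Mapping.lookup a (inv_into UNIV p q)"] prime
      by (auto simp: inj)
  qed
  show thesis
  proof (rule that, unfold monomial_weight_def, intro conjI allI)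
    show "inj N" by (rule injI, rule poly_mapping_eqI) (metis mult)
    show "N (a + b) = N a * N b" for a b
      by (simp add: N_def lookup_add power_add prod.distrib)
    show "N a > 0" for a
      unfolding N_def using prime by (intro prod_pos) (simp add: prime_gt_0_nat)
  qed
qed

lemma poly_mapping_split_at:
  fixes f :: "('n, 'k::field) mpoly"
  obtains f' where "f = Poly_Mapping.single m (Poly_Mapping.lookup f m) + f'"
    "Poly_Mapping.keys f' = Poly_Mapping.keys f - {m}"
proof
  let ?f' = "f - Poly_Mapping.single m (Poly_Mapping.lookup f m)"
  show "f = Poly_Mapping.single m (Poly_Mapping.lookup f m) + ?f'" by simp
  show "Poly_Mapping.keys ?f' = Poly_Mapping.keys f - {m}"
    by (auto simp: in_keys_iff lookup_minus lookup_single when_def split: if_splits)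
qed

text \<open>No cancellation occurs at an exponent that is a sum in only one way.\<close>

lemma lookup_mult_at_unique_sum:
  fixes f g :: "('n, 'k::field) mpoly"
  assumes uniq: "\<And>a b. a \<in> Poly_Mapping.keys f \<Longrightarrow> b \<in> Poly_Mapping.keys g \<Longrightarrow> a + b = m + n \<Longrightarrow> a = m \<and> b = n"
  shows "Poly_Mapping.lookup (f * g) (m + n) = Poly_Mapping.lookup f m * Poly_Mapping.lookup g n"
proof -
  obtain f' where f': "f = Poly_Mapping.single m (Poly_Mapping.lookup f m) + f'"
    "Poly_Mapping.keys f' = Poly_Mapping.keys f - {m}" by (rule poly_mapping_split_at)
  obtain g' where g': "g = Poly_Mapping.single n (Poly_Mapping.lookup g n) + g'"
    "Poly_Mapping.keys g' = Poly_Mapping.keys g - {n}" by (rule poly_mapping_split_at)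
  let ?s = "Poly_Mapping.single m (Poly_Mapping.lookup f m)"
  let ?t = "Poly_Mapping.single n (Poly_Mapping.lookup g n)"
  have "m + n \<notin> Poly_Mapping.keys (f' * g)"
    using keys_mult[of f' g] f'(2) uniq by fastforce
  moreover have "m + n \<notin> Poly_Mapping.keys (Poly_Mapping.single m (Poly_Mapping.lookup f m) * g')"
    using keys_mult[of "Poly_Mapping.single m (Poly_Mapping.lookup f m)" g'] g'(2)
    by (auto split: if_splits)
  moreover have "f * g = ?s * ?t + (?s * g' + f' * g)"
  proof -
    have "f * g = ?s * g + f' * g" using f'(1) by (metis distrib_right)
    also have "?s * g = ?s * ?t + ?s * g'" using g'(1) by (metis distrib_left)
    finally show ?thesis by (simp add: add.assoc)
  qed
  ultimately show ?thesis
    by (simp add: lookup_add mult_single in_keys_iff)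
qed

definition leading_exponent ::
    "(('n \<Rightarrow>\<^sub>0 nat) \<Rightarrow> nat) \<Rightarrow> ('n, 'k::field) mpoly \<Rightarrow> ('n \<Rightarrow>\<^sub>0 nat) \<Rightarrow> bool"
  where "leading_exponent N f m \<longleftrightarrow> m \<in> Poly_Mapping.keys f \<and> (\<forall>a \<in> Poly_Mapping.keys f. N a \<le> N m)"

lemma leading_exponent_exists:
  assumes "f \<noteq> 0"
  obtains m where "leading_exponent N f m"
proof -
  have "Poly_Mapping.keys f \<noteq> {}" using assms by simp
  then have "Max (N ` Poly_Mapping.keys f) \<in> N ` Poly_Mapping.keys f" by (intro Max_in) auto
  then obtain m where "m \<in> Poly_Mapping.keys f" "N m = Max (N ` Poly_Mapping.keys f)" by force
  then have "leading_exponent N f m" by (simp add: leading_exponent_def)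
  then show thesis by (rule that)
qed

lemma leading_exponent_mult:
  fixes f g :: "('n::finite, 'k::field) mpoly"
  assumes weight: "monomial_weight N"
    and f: "leading_exponent N f m" and g: "leading_exponent N g n"
  shows "leading_exponent N (f * g) (m + n)"
proof -
  have N: "inj N" "\<And>a b. N (a + b) = N a * N b" "\<And>a. N a > 0"
    using weight by (auto simp: monomial_weight_def)
  have uniq: "a = m \<and> b = n"
    if a: "a \<in> Poly_Mapping.keys f" and b: "b \<in> Poly_Mapping.keys g" and ab: "a + b = m + n" for a b
  proof -
    have le: "N a \<le> N m" "N b \<le> N n" using f g a b by (auto simp: leading_exponent_def)
    have eq: "N a * N b = N m * N n" using N(2)[of a b] N(2)[of m n] ab by simp
    have "N a = N m"
    proof (rule ccontr)
      assume "N a \<noteq> N m"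
      with le have "N a * N b < N m * N n" using N(3) by (intro mult_less_le_imp_less) auto
      with eq show False by simp
    qed
    with eq N(3)[of m] have "N b = N n" by simp
    with \<open>N a = N m\<close> show ?thesis using N(1) by (auto dest: injD)
  qed
  have "m + n \<in> Poly_Mapping.keys (f * g)"
  proof -
    have "Poly_Mapping.lookup (f * g) (m + n) = Poly_Mapping.lookup f m * Poly_Mapping.lookup g n"
      by (rule lookup_mult_at_unique_sum) (rule uniq)
    with f g show ?thesis by (simp add: leading_exponent_def in_keys_iff)
  qed
  moreover have "N c \<le> N (m + n)" if "c \<in> Poly_Mapping.keys (f * g)" for c
  proof -
    from that obtain a b where "c = a + b" "a \<in> Poly_Mapping.keys f" "b \<in> Poly_Mapping.keys g"
      using keys_mult[of f g] by blast
    with f g show ?thesis by (auto simp: leading_exponent_def N(2) intro!: mult_le_mono)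
  qed
  ultimately show ?thesis by (simp add: leading_exponent_def)
qed

lemma mpoly_mult_nonzero:
  fixes f g :: "('n::finite, 'k::field) mpoly"
  assumes "f \<noteq> 0" "g \<noteq> 0"
  shows "f * g \<noteq> 0"
proof -
  obtain N :: "('n \<Rightarrow>\<^sub>0 nat) \<Rightarrow> nat"
    where N: "monomial_weight N"
    by (rule exists_monomial_weight)
  from assms obtain m n where "leading_exponent N f m" "leading_exponent N g n"
    using leading_exponent_exists by metis
  then have "leading_exponent N (f * g) (m + n)" by (rule leading_exponent_mult[OF N])
  then show ?thesis by (auto simp: leading_exponent_def)
qed

section \<open>The Hilbert basis theorem\<close>

text \<open>Subtracting from an element of \<open>J'\<close> a scalar multiple of one of \<open>J\<close> with the same leading exponent
  lowers the leading weight, and therefore ends at \<open>0\<close>.\<close>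

lemma ideal_eq_of_leading_exponents:
  fixes J J' :: "('n::finite, 'k::field) mpoly set"
  assumes weight: "monomial_weight N" and J: "is_ideal J" "is_ideal J'" "J \<subseteq> J'"
    and lead: "\<And>g m. g \<in> J' \<Longrightarrow> leading_exponent N g m \<Longrightarrow> \<exists>f \<in> J. leading_exponent N f m"
  shows "J = J'"
proof -
  have N: "inj N" using weight by (simp add: monomial_weight_def)
  have "g \<in> J" if "g \<in> J'" "\<And>a. a \<in> Poly_Mapping.keys g \<Longrightarrow> N a < d" for g d
    using that
  proof (induction d arbitrary: g rule: less_induct)
    case (less d)
    show ?case
    proof (cases "g = 0")
      case True
      then show ?thesis using ideal_zero[OF J(1)] by simp
    next
      case False
      then obtain m where m: "leading_exponent N g m" by (rule leading_exponent_exists)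
      with less.prems lead obtain f where f: "f \<in> J" "leading_exponent N f m" by blast
      let ?c = "Poly_Mapping.lookup g m / Poly_Mapping.lookup f m"
      let ?f = "Poly_Mapping.single 0 ?c * f"
      have fJ: "?f \<in> J" using f(1) by (rule ideal_lmult[OF J(1)])
      have fm: "Poly_Mapping.lookup f m \<noteq> 0" using f(2) by (simp add: leading_exponent_def in_keys_iff)
      have "Poly_Mapping.lookup ?f (0 + m) = ?c * Poly_Mapping.lookup f m"
        by (subst lookup_mult_at_unique_sum) (auto split: if_splits)
      then have lm: "Poly_Mapping.lookup ?f m = Poly_Mapping.lookup g m" using fm by simp
      have kf: "Poly_Mapping.keys ?f \<subseteq> Poly_Mapping.keys f"
        using keys_mult[of "Poly_Mapping.single 0 ?c" f] by (auto split: if_splits)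
      have "g - ?f \<in> J"
      proof (rule less.IH)
        show "N m < d" using less.prems m by (auto simp: leading_exponent_def)
        show "g - ?f \<in> J'" using less.prems(1) fJ J by (intro ideal_diff) auto
        fix a assume a: "a \<in> Poly_Mapping.keys (g - ?f)"
        then have "a \<noteq> m" using lm by (auto simp: in_keys_iff lookup_minus)
        have "a \<in> Poly_Mapping.keys g \<or> a \<in> Poly_Mapping.keys f"
          using a kf by (auto simp: in_keys_iff lookup_minus)
        then have "N a \<le> N m" using m f(2) by (auto simp: leading_exponent_def)
        with \<open>a \<noteq> m\<close> N show "N a < N m" by (metis injD le_neq_implies_less)
      qed
      from ideal_add[OF J(1) this fJ] show ?thesis by simp
    qed
  qed
  moreover have "\<exists>d. \<forall>a\<in>Poly_Mapping.keys g. N a < d" for g :: "('n, 'k) mpoly"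
    using finite_nat_set_iff_bounded[of "N ` Poly_Mapping.keys g"] by auto
  ultimately show ?thesis using J(3) by blast
qed

text \<open>Along a strictly ascending chain each step gains a leading exponent. By Dickson's lemma
  some gained exponent is a multiple of an earlier one; it then was a leading exponent already,
  because the leading exponents of an ideal are closed under adding exponents.\<close>

theorem mpoly_noetherian:
  "wf (strictly_larger_ideal :: (('n::finite, 'k::field) mpoly set \<times> ('n, 'k) mpoly set) set)"
  unfolding wf_iff_no_infinite_down_chain
proof
  assume "\<exists>J. \<forall>i. (J (Suc i), J i) \<in> (strictly_larger_ideal :: (('n, 'k) mpoly set \<times> _) set)"
  then obtain J :: "nat \<Rightarrow> ('n, 'k) mpoly set"
    where "\<And>i. (J (Suc i), J i) \<in> strictly_larger_ideal" by blast
  then have J: "is_ideal (J i)" "J i \<subset> J (Suc i)" for i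
    by (auto simp: strictly_larger_ideal_def)
  obtain N :: "('n \<Rightarrow>\<^sub>0 nat) \<Rightarrow> nat"
    where N: "monomial_weight N"
    by (rule exists_monomial_weight)
  define L where "L i = {m. \<exists>f \<in> J i. leading_exponent N f m}" for i
  have "\<exists>m. m \<in> L (Suc i) - L i" for i
    using ideal_eq_of_leading_exponents[OF N J(1) J(1), of i "Suc i"] J(2)[of i]
    by (auto simp: L_def)
  then obtain m where m: "\<And>i. m i \<in> L (Suc i) - L i" by metis
  obtain i j where ij: "i < j" "Poly_Mapping.lookup (m i) \<le> Poly_Mapping.lookup (m j)"
    by (rule dickson)
  have "m i + (m j - m i) = m j"
    using ij(2) by (intro poly_mapping_eqI) (simp add: lookup_add lookup_minus le_fun_def)
  moreover obtain f where f: "f \<in> J (Suc i)" "leading_exponent N f (m i)"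
    using m[of i] by (auto simp: L_def)
  moreover have "leading_exponent N (Poly_Mapping.single (m j - m i) (1::'k)) (m j - m i)"
    by (simp add: leading_exponent_def)
  ultimately have "leading_exponent N (f * Poly_Mapping.single (m j - m i) 1) (m j)"
    using leading_exponent_mult[OF N f(2)] by metis
  moreover have "J (Suc i) \<subseteq> J j"
  proof (rule lift_Suc_mono_le)
    show "J k \<subseteq> J (Suc k)" for k using J(2)[of k] by (rule psubset_imp_subset)
  qed (use ij(1) in simp)
  ultimately have "m j \<in> L j"
    using ideal_rmult[OF J(1)[of j], of f] f(1) unfolding L_def by blast
  with m show False by blast
qed

section \<open>The grading of the polynomial ring\<close>

lemma mdeg_add: "mdeg (a + b) = mdeg a + mdeg b"
  by (simp add: mdeg_def lookup_add sum.distrib)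

lemma mdeg_zero [simp]: "mdeg 0 = 0"
  by (simp add: mdeg_def)

lemma mdeg_eq_0_iff: "mdeg m = 0 \<longleftrightarrow> m = 0"
  by (auto simp: mdeg_def intro: poly_mapping_eqI)

text \<open>These ideals form the filtration belonging to the grading. It controls the degrees of elements
  of powers of an ideal without decomposing them into components.\<close>

definition degree_at_least :: "nat \<Rightarrow> ('n::finite, 'k::field) mpoly set"
  where "degree_at_least d = {f. \<forall>m \<in> Poly_Mapping.keys f. d \<le> mdeg m}"

lemma graded_part_mult:
  assumes "f \<in> graded_part d" "g \<in> graded_part e" shows "f * g \<in> graded_part (d + e)"
  unfolding graded_part_def
proof safe
  fix m assume "m \<in> Poly_Mapping.keys (f * g)"
  with keys_mult[of f g] obtain a b where "m = a + b" "a \<in> Poly_Mapping.keys f" "b \<in> Poly_Mapping.keys g"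
    by blast
  with assms show "mdeg m = d + e" by (simp add: mdeg_add graded_part_def)
qed

lemma degree_at_least_mult:
  assumes "f \<in> degree_at_least d" "g \<in> degree_at_least e" shows "f * g \<in> degree_at_least (d + e)"
  unfolding degree_at_least_def
proof safe
  fix m assume "m \<in> Poly_Mapping.keys (f * g)"
  with keys_mult[of f g] obtain a b where "m = a + b" "a \<in> Poly_Mapping.keys f" "b \<in> Poly_Mapping.keys g"
    by blast
  with assms show "d + e \<le> mdeg m" by (simp add: mdeg_add degree_at_least_def add_mono)
qed

lemma degree_at_least_add:
  "f \<in> degree_at_least d \<Longrightarrow> g \<in> degree_at_least d \<Longrightarrow> f + g \<in> degree_at_least d"
  using keys_add[of f g] by (auto simp: degree_at_least_def)

lemma graded_part_subset_degree_at_least: "f \<in> graded_part d \<Longrightarrow> f \<in> degree_at_least d"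
  by (simp add: graded_part_def degree_at_least_def)

lemma graded_part_one: "1 \<in> graded_part 0"
  by (simp add: graded_part_def)

lemma graded_part_power: "f \<in> graded_part d \<Longrightarrow> f ^ k \<in> graded_part (d * k)"
  by (induction k) (auto simp: graded_part_one dest: graded_part_mult)

lemma degree_le_of_graded_part:
  assumes "f \<in> graded_part d" "f \<in> degree_at_least e" "f \<noteq> 0" shows "e \<le> d"
proof -
  from assms(3) obtain m where "m \<in> Poly_Mapping.keys f" by fastforce
  with assms(1,2) show ?thesis by (auto simp: graded_part_def degree_at_least_def)
qed

lemma lookup_hom_component:
  "Poly_Mapping.lookup (hom_component d f) m = (if mdeg m = d then Poly_Mapping.lookup f m else 0)"
proof -
  let ?A = "{m \<in> Poly_Mapping.keys f. mdeg m = d}"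
  have "Poly_Mapping.lookup (hom_component d f) m = (\<Sum>a\<in>?A. if a = m then Poly_Mapping.lookup f a else 0)"
    unfolding hom_component_def by (simp add: lookup_sum lookup_single when_def)
  also have "\<dots> = (if m \<in> ?A then Poly_Mapping.lookup f m else 0)"
    by (simp add: sum.delta)
  finally show ?thesis by (simp add: in_keys_iff)
qed

lemma hom_component_in_graded_part: "hom_component d f \<in> graded_part d"
  unfolding graded_part_def mem_Collect_eq
proof
  fix m assume "m \<in> Poly_Mapping.keys (hom_component d f)"
  then have "Poly_Mapping.lookup (hom_component d f) m \<noteq> 0" by (rule in_keys_iff[THEN iffD1])
  then show "mdeg m = d" by (metis lookup_hom_component)
qed

lemma hom_component_add: "hom_component d (f + g) = hom_component d f + hom_component d g"
  by (intro poly_mapping_eqI) (simp add: lookup_hom_component lookup_add)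

lemma hom_component_sum: "hom_component d (sum f A) = (\<Sum>i\<in>A. hom_component d (f i))"
  by (intro poly_mapping_eqI) (simp add: lookup_hom_component lookup_sum)

lemma hom_component_of_graded_part:
  "f \<in> graded_part e \<Longrightarrow> hom_component d f = (if d = e then f else 0)"
  by (intro poly_mapping_eqI) (auto simp: lookup_hom_component graded_part_def in_keys_iff)

lemma hom_component_of_degree_at_least:
  "f \<in> degree_at_least e \<Longrightarrow> d < e \<Longrightarrow> hom_component d f = 0"
  by (intro poly_mapping_eqI) (force simp: lookup_hom_component degree_at_least_def in_keys_iff)

lemma sum_hom_components: "f = (\<Sum>d \<in> mdeg ` Poly_Mapping.keys f. hom_component d f)"
proof (rule poly_mapping_eqI)
  fix m
  have "(\<Sum>d \<in> mdeg ` Poly_Mapping.keys f. Poly_Mapping.lookup (hom_component d f) m)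
    = (\<Sum>d \<in> mdeg ` Poly_Mapping.keys f. if d = mdeg m then Poly_Mapping.lookup f m else 0)"
    by (intro sum.cong) (auto simp: lookup_hom_component)
  also have "\<dots> = Poly_Mapping.lookup f m"
    by (auto simp: sum.delta in_keys_iff)
  finally show "Poly_Mapping.lookup f m = Poly_Mapping.lookup (\<Sum>d \<in> mdeg ` Poly_Mapping.keys f. hom_component d f) m"
    by (simp add: lookup_sum)
qed

text \<open>Multiplication by a homogeneous element shifts components, by comparing the two sides on each
  component of \<open>g\<close>.\<close>

lemma hom_component_mult:
  assumes "h \<in> graded_part e"
  shows "hom_component (d + e) (g * h) = hom_component d g * h"
proof -
  let ?D = "mdeg ` Poly_Mapping.keys g"
  have "hom_component (d + e) (g * h) = hom_component (d + e) (\<Sum>i\<in>?D. hom_component i g * h)"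
    using sum_hom_components[of g] by (simp flip: sum_distrib_right)
  also have "\<dots> = (\<Sum>i\<in>?D. if i = d then hom_component i g * h else 0)"
    unfolding hom_component_sum
    by (intro sum.cong refl)
      (simp add: hom_component_of_graded_part[OF graded_part_mult[OF hom_component_in_graded_part assms]])
  also have "\<dots> = (if d \<in> ?D then hom_component d g * h else 0)"
    by (simp add: sum.delta)
  also have "\<dots> = hom_component d g * h"
  proof (cases "d \<in> ?D")
    case False
    then have "hom_component d g = 0"
      by (intro poly_mapping_eqI) (auto simp: lookup_hom_component in_keys_iff)
    then show ?thesis by simp
  qed simp
  finally show ?thesis .
qed

section \<open>Graded ideals and homogeneous witnesses\<close>

lemma graded_idealD:
  assumes "graded_ideal I" shows "is_ideal I" "f \<in> I \<Longrightarrow> hom_component d f \<in> I"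
  using assms by (simp_all add: graded_ideal_def)

lemma graded_ideal_colon:
  assumes I: "graded_ideal I" and h: "h \<in> graded_part e"
  shows "graded_ideal (colon I h)"
proof -
  have "hom_component d g \<in> colon I h" if "g \<in> colon I h" for g d
    using graded_idealD(2)[OF I, of "g * h" "d + e"] that
    by (simp add: mem_colon hom_component_mult[OF h])
  with is_ideal_colon[OF graded_idealD(1)[OF I]] show ?thesis by (simp add: graded_ideal_def)
qed

lemma graded_ideal_not_mem_component:
  assumes "is_ideal I" "f \<notin> I"
  obtains d where "hom_component d f \<notin> I"
proof -
  have "\<exists>d. hom_component d f \<notin> I"
  proof (rule ccontr)
    assume "\<nexists>d. hom_component d f \<notin> I"
    then have "(\<Sum>d \<in> mdeg ` Poly_Mapping.keys f. hom_component d f) \<in> I"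
      by (intro ideal_sum[OF assms(1)]) simp
    with assms(2) sum_hom_components[of f] show False by simp
  qed
  with that show thesis by blast
qed

text \<open>Here \<open>u\<close> is the lowest component of \<open>x\<close> outside \<open>I\<close>; modulo \<open>I\<close>, it is the
  initial form of \<open>x\<close>.\<close>

lemma lowest_component_outside:
  assumes I: "graded_ideal I" and "x \<notin> I"
  obtains q u r d where "q \<in> I" "u \<in> graded_part d" "u \<notin> I" "r \<in> degree_at_least (Suc d)" "x = q + u + r"
proof -
  have ideal: "is_ideal I" using I by (rule graded_idealD)
  define d where "d = (LEAST d. hom_component d x \<notin> I)"
  obtain d0 where "hom_component d0 x \<notin> I"
    using graded_ideal_not_mem_component[OF ideal assms(2)] .
  then have d: "hom_component d x \<notin> I" unfolding d_def by (rule LeastI)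
  have low: "hom_component i x \<in> I" if "i < d" for i
    using not_less_Least[of i "\<lambda>d. hom_component d x \<notin> I"] that unfolding d_def by blast
  define q where "q = (\<Sum>i<d. hom_component i x)"
  define r where "r = x - q - hom_component d x"
  have lq: "Poly_Mapping.lookup q m = (if mdeg m < d then Poly_Mapping.lookup x m else 0)" for m
    by (auto simp: q_def lookup_sum lookup_hom_component sum.delta' eq_commute[of "mdeg m"])
  have "r \<in> degree_at_least (Suc d)"
    by (auto simp: degree_at_least_def r_def in_keys_iff lookup_minus lq lookup_hom_component
        Suc_le_eq split: if_splits)
  moreover have "q \<in> I" unfolding q_def using low by (intro ideal_sum[OF ideal]) simp
  moreover have "x = q + hom_component d x + r" by (simp add: r_def)
  ultimately show thesis using that hom_component_in_graded_part d by blast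
qed

text \<open>Modulo \<open>I\<close>, the lowest component of a product is the product of the lowest components.\<close>

lemma graded_ideal_prime_if_prime_on_homogeneous:
  assumes I: "graded_ideal I" and one: "1 \<notin> I"
    and hom: "\<And>a b d e. a \<in> graded_part d \<Longrightarrow> b \<in> graded_part e \<Longrightarrow> a * b \<in> I \<Longrightarrow> a \<in> I \<or> b \<in> I"
  shows "is_prime_ideal I"
  unfolding is_prime_ideal_iff
proof (intro conjI allI impI one)
  show ideal: "is_ideal I" using I by (rule graded_idealD)
  fix x y assume xy: "x * y \<in> I"
  show "x \<in> I \<or> y \<in> I"
  proof (rule ccontr)
    assume "\<not> ?thesis"
    then have nx: "x \<notin> I" and ny: "y \<notin> I" by auto
    obtain q u r d where x: "q \<in> I" "u \<in> graded_part d" "u \<notin> I" "r \<in> degree_at_least (Suc d)" "x = q + u + r"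
      by (rule lowest_component_outside[OF I nx])
    obtain q' v r' e where y: "q' \<in> I" "v \<in> graded_part e" "v \<notin> I" "r' \<in> degree_at_least (Suc e)" "y = q' + v + r'"
      by (rule lowest_component_outside[OF I ny])
    let ?R = "u * r' + r * v + r * r'"
    have "u * v + ?R = x * y - (q * y + (u + r) * q')"
      unfolding x(5) y(5) by (simp add: algebra_simps)
    moreover have "q * y + (u + r) * q' \<in> I"
      using ideal_add[OF ideal ideal_rmult[OF ideal x(1)] ideal_lmult[OF ideal y(1)]] .
    ultimately have "u * v + ?R \<in> I" using ideal_diff[OF ideal xy] by simp
    then have "hom_component (d + e) (u * v + ?R) \<in> I" by (rule graded_idealD(2)[OF I])
    moreover have "hom_component (d + e) (u * v) = u * v"
      using hom_component_of_graded_part[OF graded_part_mult[OF x(2) y(2)], of "d + e"] by simp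
    moreover have "hom_component (d + e) ?R = 0"
    proof -
      have "u * r' \<in> degree_at_least (d + Suc e)" "r * v \<in> degree_at_least (Suc d + e)"
        "r * r' \<in> degree_at_least (Suc d + Suc e)"
        by (intro degree_at_least_mult x y graded_part_subset_degree_at_least)+
      then show ?thesis by (simp add: hom_component_add hom_component_of_degree_at_least)
    qed
    ultimately have "u * v \<in> I" by (simp add: hom_component_add)
    with hom[OF x(2) y(2)] x(3) y(3) show False by blast
  qed
qed

text \<open>The maximal colon construction over homogeneous multipliers yields a graded prime between \<open>I\<close>
  and \<open>P\<close>; minimality identifies it with \<open>P\<close>. In particular, the degrees of which the v-number is the
  minimum do exist.\<close>

lemma minimal_prime_homogeneous_witness:
  fixes I :: "('n::finite, 'k::field) mpoly set"
  assumes I: "graded_ideal I" and P: "P \<in> minimal_primes I"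
  obtains d f where "f \<in> graded_part d" "colon I f = P"
proof -
  have ideal: "is_ideal I" using I by (rule graded_idealD)
  have prime: "is_prime_ideal P" and IP: "I \<subseteq> P"
    and min: "\<And>Q. is_prime_ideal Q \<Longrightarrow> I \<subseteq> Q \<Longrightarrow> Q \<subseteq> P \<Longrightarrow> Q = P"
    using P by (auto simp: minimal_primes_def)
  define H :: "('n, 'k) mpoly set" where "H = (\<Union>d. graded_part d)"
  have H: "a * b \<in> H" if "a \<in> H" "b \<in> H" for a b
    using that graded_part_mult unfolding H_def by blast
  have T: "s * t \<in> - P" if "s \<in> - P" "t \<in> - P" for s t
    using prime that unfolding is_prime_ideal_iff by blast
  have one: "1 \<in> H" using graded_part_one by (auto simp: H_def)
  have graded: "graded_ideal (colon I (h * 1))" if "h \<in> H" for h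
    using that graded_ideal_colon[OF I] by (auto simp: H_def)
  \<comment> \<open>A graded ideal that leaves \<open>P\<close> does so through a homogeneous element.\<close>
  have HT: "colon I (h * 1) \<inter> - P \<inter> H \<noteq> {}" if h: "h \<in> H" and ne: "colon I (h * 1) \<inter> - P \<noteq> {}" for h
  proof -
    from ne obtain s where s: "s \<in> colon I (h * 1)" "s \<notin> P" by blast
    obtain d where "hom_component d s \<notin> P"
      using graded_ideal_not_mem_component[OF prime_imp_ideal[OF prime] s(2)] .
    moreover have "hom_component d s \<in> colon I (h * 1)" using graded_idealD(2)[OF graded[OF h] s(1)] .
    moreover have "hom_component d s \<in> H" using hom_component_in_graded_part by (auto simp: H_def)
    ultimately show ?thesis by blast
  qed
  have disj: "colon I 1 \<inter> - P = {}" using IP by (auto simp: mem_colon)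
  obtain h where h: "h \<in> H" "colon I (h * 1) \<inter> - P = {}"
    and pr: "\<And>a b. a \<in> H \<Longrightarrow> b \<in> H \<Longrightarrow> a * b \<in> colon I (h * 1) \<Longrightarrow>
      a \<in> colon I (h * 1) \<or> b \<in> colon I (h * 1)"
    using prime_on_maximal_colon[OF mpoly_noetherian ideal T one H HT disj] by blast
  have "is_prime_ideal (colon I (h * 1))"
  proof (rule graded_ideal_prime_if_prime_on_homogeneous[OF graded[OF h(1)]])
    show "1 \<notin> colon I (h * 1)" using h(2) prime unfolding is_prime_ideal_iff by blast
    fix a b d e assume "a \<in> graded_part d" "b \<in> graded_part e" "a * b \<in> colon I (h * 1)"
    then show "a \<in> colon I (h * 1) \<or> b \<in> colon I (h * 1)" by (intro pr) (auto simp: H_def)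
  qed
  then have "colon I (h * 1) = P"
    using h(2) ideal_subset_colon[OF ideal] by (intro min) auto
  with h(1) that show thesis by (auto simp: H_def)
qed

section \<open>Initial degrees\<close>

lemma initial_degree_le: "h \<in> P \<Longrightarrow> h \<noteq> 0 \<Longrightarrow> h \<in> graded_part d \<Longrightarrow> initial_degree P \<le> d"
  unfolding initial_degree_def by (rule Least_le) blast

lemma initial_degree_attained:
  assumes I: "graded_ideal I" and "I \<noteq> {0}" and IP: "I \<subseteq> P"
  obtains h where "h \<in> P" "h \<noteq> 0" "h \<in> graded_part (initial_degree P)"
proof -
  obtain f where f: "f \<in> I" "f \<noteq> 0"
    using assms(2) ideal_zero[OF graded_idealD(1)[OF I]] by blast
  have "is_ideal ({0} :: ('a, 'b) mpoly set)" by (simp add: is_ideal_iff)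
  then obtain d where "hom_component d f \<notin> {0}"
    using graded_ideal_not_mem_component f(2) by blast
  then have "\<exists>d. \<exists>f \<in> P - {0}. f \<in> graded_part d"
    using graded_idealD(2)[OF I f(1)] IP hom_component_in_graded_part by blast
  from LeastI_ex[OF this] that show thesis unfolding initial_degree_def by blast
qed

lemma initial_degree_mono:
  assumes "graded_ideal I" "I \<noteq> {0}" "I \<subseteq> P"
  shows "initial_degree P \<le> initial_degree I"
proof -
  obtain h where "h \<in> I" "h \<noteq> 0" "h \<in> graded_part (initial_degree I)"
    using initial_degree_attained[OF assms(1,2) order_refl] .
  with assms(3) show ?thesis by (intro initial_degree_le) auto
qed

lemma degree_zero_unit:
  fixes h :: "('n::finite, 'k::field) mpoly"
  assumes h: "h \<in> graded_part 0" "h \<noteq> 0"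
  obtains g where "g * h = 1"
proof -
  let ?c = "Poly_Mapping.lookup h 0"
  have eq: "h = Poly_Mapping.single 0 ?c"
    using h(1) by (intro poly_mapping_eqI)
      (auto simp: graded_part_def mdeg_eq_0_iff lookup_single when_def in_keys_iff)
  with h(2) have "?c \<noteq> 0" by (metis single_zero)
  then have "Poly_Mapping.single 0 (1 / ?c) * h = 1"
    by (subst eq) (simp add: mult_single)
  with that show thesis by blast
qed

text \<open>A homogeneous element of degree \<open>0\<close> is a constant, hence a unit when nonzero; a proper ideal contains none.\<close>

lemma initial_degree_prime_pos:
  assumes I: "graded_ideal I" "I \<noteq> {0}" "I \<subseteq> P" and P: "is_prime_ideal P"
  shows "initial_degree P > 0"
proof (rule ccontr)
  assume "\<not> ?thesis"
  then obtain h where h: "h \<in> P" "h \<noteq> 0" "h \<in> graded_part 0"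
    using initial_degree_attained[OF I] by auto
  then obtain g where "g * h = 1" using degree_zero_unit by blast
  with ideal_lmult[OF prime_imp_ideal[OF P] h(1), of g] P show False
    by (simp add: is_prime_ideal_iff)
qed

lemma graded_ideal_subset_degree_at_least:
  assumes I: "graded_ideal I" shows "I \<subseteq> degree_at_least (initial_degree I)"
proof
  fix f assume f: "f \<in> I"
  have "initial_degree I \<le> mdeg m" if "m \<in> Poly_Mapping.keys f" for m
  proof (rule initial_degree_le)
    show "hom_component (mdeg m) f \<in> I" using graded_idealD(2)[OF I f] .
    show "hom_component (mdeg m) f \<noteq> 0"
    proof
      assume "hom_component (mdeg m) f = 0"
      then have "Poly_Mapping.lookup (hom_component (mdeg m) f) m = 0" by simp
      with that show False by (simp add: lookup_hom_component in_keys_iff)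
    qed
  qed (rule hom_component_in_graded_part)
  then show "f \<in> degree_at_least (initial_degree I)" by (simp add: degree_at_least_def)
qed

lemma ideal_power_subset_degree_at_least:
  assumes I: "graded_ideal I"
  shows "ideal_power I k \<subseteq> degree_at_least (initial_degree I * k)"
proof (induction k)
  case 0
  show ?case by (auto simp: degree_at_least_def)
next
  case (Suc k)
  show ?case
  proof
    fix f assume "f \<in> ideal_power I (Suc k)"
    then show "f \<in> degree_at_least (initial_degree I * Suc k)"
    proof (induction rule: ideal_power_Suc_induct)
      case (mult a b)
      then have "b * a \<in> degree_at_least (initial_degree I + initial_degree I * k)"
        using Suc graded_ideal_subset_degree_at_least[OF I] by (intro degree_at_least_mult) auto
      then show ?case by (simp add: mult.commute)
    next
      case (add a b)
      then show ?case by (rule degree_at_least_add)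
    qed
  qed
qed

section \<open>Witnesses of associated primes of powers\<close>

text \<open>A form \<open>p\<close> of least degree in \<open>P\<close> multiplies \<open>g\<close> to a nonzero form in \<open>I\<^sup>k\<close>, and
  all nonzero forms there have degree at least \<open>k \<alpha>(I)\<close>.\<close>

lemma homogeneous_witness_degree_bound:
  assumes I: "graded_ideal I" "I \<noteq> {0}" and P: "P \<in> Ass (ideal_power I k)" "I \<subseteq> P"
    and g: "g \<in> graded_part d" "colon (ideal_power I k) g = P"
  shows "initial_degree I * k \<le> d + initial_degree P"
proof -
  obtain p where p: "p \<in> P" "p \<noteq> 0" "p \<in> graded_part (initial_degree P)"
    using initial_degree_attained[OF I P(2)] .
  have "1 \<notin> P" using AssD(1)[OF P(1)] by (simp add: is_prime_ideal_iff)
  then have "g \<notin> ideal_power I k" using g(2) by (auto simp: mem_colon)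
  then have "g \<noteq> 0" using ideal_zero[OF is_ideal_power[OF graded_idealD(1)[OF I(1)]]] by metis
  have "p * g \<in> ideal_power I k" using p(1) g(2) mem_colon by blast
  then have "g * p \<in> degree_at_least (initial_degree I * k)"
    using ideal_power_subset_degree_at_least[OF I(1)] by (auto simp: mult.commute)
  from degree_le_of_graded_part[OF graded_part_mult[OF g(1) p(3)] this mpoly_mult_nonzero[OF \<open>g \<noteq> 0\<close> p(2)]]
  show ?thesis .
qed

text \<open>The witness is \<open>g = h\<^sup>k\<^sup>-\<^sup>1 f\<close> for a form \<open>h \<in> I\<close> of least degree. Certainly \<open>P g \<subseteq> I\<^sup>k\<close>, and
  \<open>g \<notin> I\<^sup>k\<close> because it is a nonzero form of degree \<open>k \<alpha>(I) - \<alpha>(P)\<close>, less than \<open>k \<alpha>(I)\<close>. So \<open>(I\<^sup>k : g)\<close> lies between \<open>P\<close> and an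
  associated prime of \<open>I\<^sup>k\<close>. That prime is associated to \<open>I\<close>, so in the absence of embedded primes it can
  only be \<open>P\<close>.\<close>

lemma homogeneous_witness_for_power:
  fixes I :: "('n::finite, 'k::field) mpoly set"
  assumes I: "graded_ideal I" "I \<noteq> {0}" and emb: "embedded_primes I = {}"
    and ntf: "normally_torsion_free I"
    and P: "P \<in> Ass I" and f: "f \<in> graded_part d" "colon I f = P"
    and d: "d + initial_degree P = initial_degree I" and k: "k \<ge> 1"
  obtains e g where "g \<in> graded_part e" "colon (ideal_power I k) g = P"
    "e + initial_degree P = initial_degree I * k"
proof -
  have ideal: "is_ideal I" using I(1) by (rule graded_idealD)
  have IP: "I \<subseteq> P" using Ass_contains[OF ideal P] .
  obtain j where j: "k = Suc j" using k by (cases k) auto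
  obtain h where h: "h \<in> I" "h \<noteq> 0" "h \<in> graded_part (initial_degree I)"
    using initial_degree_attained[OF I order_refl] .
  define g where "g = h ^ j * f"
  define e where "e = initial_degree I * j + d"
  have ge: "g \<in> graded_part e"
    unfolding g_def e_def by (intro graded_part_mult graded_part_power h f)
  have deg: "e + initial_degree P = initial_degree I * k"
    using d by (simp add: e_def j)
  have "1 \<notin> P" using AssD(1)[OF P] by (simp add: is_prime_ideal_iff)
  then have "f \<noteq> 0" using f(2) ideal_zero[OF ideal] by (auto simp: mem_colon)
  moreover have "h ^ i \<noteq> 0" for i
    by (induction i) (simp_all add: mpoly_mult_nonzero h(2))
  ultimately have "g \<noteq> 0" unfolding g_def by (intro mpoly_mult_nonzero)
  have "g \<notin> ideal_power I k"
  proof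
    assume "g \<in> ideal_power I k"
    then have "initial_degree I * k \<le> e"
      using degree_le_of_graded_part[OF ge] ideal_power_subset_degree_at_least[OF I(1)] \<open>g \<noteq> 0\<close> by blast
    with deg initial_degree_prime_pos[OF I IP AssD(1)[OF P]] show False by linarith
  qed
  then obtain Q where Q: "Q \<in> Ass (ideal_power I k)" "colon (ideal_power I k) g \<subseteq> Q"
    by (rule colon_subset_associated_prime[OF mpoly_noetherian is_ideal_power[OF ideal]])
  have "P \<subseteq> colon (ideal_power I k) g"
  proof
    fix p assume "p \<in> P"
    then have "p * f \<in> I" using f(2) mem_colon by blast
    then have "h ^ j * (p * f) \<in> ideal_power I k"
      unfolding j by (intro mult_mem_ideal_power power_mem_ideal_power h(1))
    then show "p \<in> colon (ideal_power I k) g"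
      by (simp add: mem_colon g_def mult.left_commute)
  qed
  moreover have "P = Q"
  proof (rule Ass_eq_of_subset[OF emb P])
    show "Q \<in> Ass I" using ntf k Q(1) by (auto simp: normally_torsion_free_def)
    show "P \<subseteq> Q" using calculation Q(2) by blast
  qed
  ultimately have "colon (ideal_power I k) g = P" using Q(2) by blast
  with that[OF ge _ deg] show thesis by simp
qed

lemma local_v_number_attained:
  assumes "f \<in> graded_part d" "colon I f = P"
  obtains g where "g \<in> graded_part (local_v_number P I)" "colon I g = P"
proof -
  have "\<exists>d. \<exists>f \<in> graded_part d. colon I f = P" using assms by blast
  from LeastI_ex[OF this] that show thesis unfolding local_v_number_def by blast
qed

lemma local_v_number_eqI:
  assumes "f \<in> graded_part d" "colon I f = P"
    and "\<And>g e. g \<in> graded_part e \<Longrightarrow> colon I g = P \<Longrightarrow> d \<le> e"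
  shows "local_v_number P I = d"
  unfolding local_v_number_def using assms by (intro Least_equality) blast+

lemma v_number_attained:
  assumes "f \<in> graded_part d" "colon I f = P" "P \<in> Ass I"
  obtains g Q where "g \<in> graded_part (v_number I)" "colon I g = Q" "Q \<in> Ass I"
proof -
  have "\<exists>d. \<exists>f \<in> graded_part d. \<exists>P \<in> Ass I. colon I f = P" using assms by blast
  from LeastI_ex[OF this] that show thesis unfolding v_number_def by blast
qed

lemma v_number_eqI:
  assumes "f \<in> graded_part d" "colon I f = P" "P \<in> Ass I"
    and "\<And>g e Q. g \<in> graded_part e \<Longrightarrow> colon I g = Q \<Longrightarrow> Q \<in> Ass I \<Longrightarrow> d \<le> e"
  shows "v_number I = d"
  unfolding v_number_def using assms by (intro Least_equality) blast+

lemma initial_degree_le_max_initial_degree: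
  assumes "graded_ideal I" "I \<noteq> {0}" "P \<in> Ass I"
  shows "initial_degree P \<le> max_initial_degree I"
  unfolding max_initial_degree_def
proof (rule Max_ge)
  have "initial_degree ` Ass I \<subseteq> {..initial_degree I}"
    using initial_degree_mono[OF assms(1,2)] Ass_contains[OF graded_idealD(1)[OF assms(1)]] by auto
  then show "finite (initial_degree ` Ass I)" by (rule finite_subset) simp
qed (use assms in simp)

theorem proposition3p3:
  fixes I :: "('n::finite, 'k::field) mpoly set"
  assumes "graded_ideal I"
    and "I \<noteq> {0}"
    and "I \<noteq> UNIV"
    and "embedded_primes I = {}"
  shows "(normally_torsion_free I \<longleftrightarrow> (\<forall>k\<ge>1. ideal_power I k = symbolic_power I k))
    \<and> (normally_torsion_free I \<longrightarrow>
        (\<forall>P \<in> Ass I.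
          int (local_v_number P I) = int (initial_degree I) - int (initial_degree P) \<longrightarrow>
          (\<forall>k\<ge>1. P \<in> Ass (ideal_power I k) \<and>
            int (local_v_number P (ideal_power I k))
              = int (initial_degree I) * int k - int (initial_degree P)))
      \<and> (int (v_number I) = int (initial_degree I) - int (max_initial_degree I) \<longrightarrow>
          (\<forall>k\<ge>1. int (v_number (ideal_power I k))
              = int (initial_degree I) * int k - int (max_initial_degree I))))"
proof (intro conjI impI ballI allI)
  note I = assms(1,2) and emb = assms(4)
  have ideal: "is_ideal I" using assms(1) by (rule graded_idealD)
  show "normally_torsion_free I \<longleftrightarrow> (\<forall>k\<ge>1. ideal_power I k = symbolic_power I k)"
    by (rule normally_torsion_free_iff_symbolic_powers[OF mpoly_noetherian ideal assms(3,4)])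
  assume ntf: "normally_torsion_free I"
  have witness: "\<exists>d. \<exists>f \<in> graded_part d. colon I f = P" if "P \<in> Ass I" for P
    using minimal_prime_homogeneous_witness[OF I(1)
        associated_prime_is_minimal[OF mpoly_noetherian ideal emb that]] by blast
  have Ass_power: "Q \<in> Ass I" if "Q \<in> Ass (ideal_power I k)" "k \<ge> 1" for Q k
    using ntf that by (auto simp: normally_torsion_free_def)
  have bound: "initial_degree I * k \<le> e + initial_degree Q"
    if "k \<ge> 1" "Q \<in> Ass (ideal_power I k)" "g \<in> graded_part e" "colon (ideal_power I k) g = Q" for k Q g e
    using homogeneous_witness_degree_bound[OF I that(2) Ass_contains[OF ideal] that(3,4)]
      Ass_power that by blast
  {
    fix P k assume P: "P \<in> Ass I" and k: "k \<ge> (1::nat)"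
      and v: "int (local_v_number P I) = int (initial_degree I) - int (initial_degree P)"
    obtain f where f: "f \<in> graded_part (local_v_number P I)" "colon I f = P"
      using witness[OF P] local_v_number_attained by metis
    have "local_v_number P I + initial_degree P = initial_degree I" using v by linarith
    then obtain e g where g: "g \<in> graded_part e" "colon (ideal_power I k) g = P"
      "e + initial_degree P = initial_degree I * k"
      by (rule homogeneous_witness_for_power[OF I emb ntf P f _ k])
    show PA: "P \<in> Ass (ideal_power I k)" using AssD(1)[OF P] g(2) by (auto simp: Ass_def)
    have "local_v_number P (ideal_power I k) = e"
    proof (rule local_v_number_eqI[OF g(1,2)])
      fix g' e' assume "g' \<in> graded_part e'" "colon (ideal_power I k) g' = P"
      from bound[OF k PA this] g(3) show "e \<le> e'" by linarith
    qed
    with g(3) show "int (local_v_number P (ideal_power I k))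
        = int (initial_degree I) * int k - int (initial_degree P)"
      by (simp flip: of_nat_mult)
  }
  {
    fix k assume k: "k \<ge> (1::nat)"
      and v: "int (v_number I) = int (initial_degree I) - int (max_initial_degree I)"
    have "1 \<notin> I" using ideal_eq_UNIV[OF ideal] assms(3) by blast
    then obtain P0 where "P0 \<in> Ass I" by (rule colon_subset_associated_prime[OF mpoly_noetherian ideal])
    with witness obtain d0 f0 where "f0 \<in> graded_part d0" "colon I f0 = P0" by blast
    then obtain f P where f: "f \<in> graded_part (v_number I)" "colon I f = P" and P: "P \<in> Ass I"
      using v_number_attained[OF _ _ \<open>P0 \<in> Ass I\<close>] by blast
    \<comment> \<open>The degree bound for \<open>k = 1\<close> forces \<open>P\<close> to have the largest initial degree.\<close>
    have "initial_degree I \<le> v_number I + initial_degree P"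
      using bound[of 1 P f "v_number I"] f P by (simp only: ideal_power_1[OF ideal]) simp
    then have max: "initial_degree P = max_initial_degree I"
      using initial_degree_le_max_initial_degree[OF I P] v by linarith
    then have "v_number I + initial_degree P = initial_degree I" using v by linarith
    then obtain e g where g: "g \<in> graded_part e" "colon (ideal_power I k) g = P"
      "e + initial_degree P = initial_degree I * k"
      by (rule homogeneous_witness_for_power[OF I emb ntf P f _ k])
    have PA: "P \<in> Ass (ideal_power I k)" using AssD(1)[OF P] g(2) by (auto simp: Ass_def)
    have "v_number (ideal_power I k) = e"
    proof (rule v_number_eqI[OF g(1,2) PA])
      fix g' e' Q assume g': "g' \<in> graded_part e'" "colon (ideal_power I k) g' = Q"
        and Q: "Q \<in> Ass (ideal_power I k)"
      from bound[OF k Q g'] initial_degree_le_max_initial_degree[OF I Ass_power[OF Q k]] g(3) max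
      show "e \<le> e'" by linarith
    qed
    with g(3) max show "int (v_number (ideal_power I k))
        = int (initial_degree I) * int k - int (max_initial_degree I)"
      by (simp flip: of_nat_mult)
  }
qed

end
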